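(* Let $\mathcal{A}$ be a real central hyperplane arrangement with fundamental chamber $c_0$, and assume that every subset of $\mathcal{A}$ that is biclosed (with respect to $c_0$) equals $S(c)$ for some chamber $c$. \begin{enumerate} \item A total order on $\mathcal{A}$ is admissible if and only if there exists a reduced gallery from $c_0$ to $-c_0$ inducing that order. \item Let $r$ be a reduced gallery from $c_0$ to $-c_0$ and let $X$ be a codimension $2$ intersection subspace of $\mathcal{A}$. If, in the total order on $\mathcal{A}$ induced by $r$, the hyperplanes of $\mathcal{A}_X$ appear consecutively, then there exists a reduced gallery from $c_0$ to $-c_0$ whose induced total order is obtained from that of $r$ by reversing the order of the consecutive block of hyperplanes of $\mathcal{A}_X$ (and leaving all other positions unchanged). \end{enumerate}
   Context: A real central hyperplane arrangement $\mathcal{A}$ is a finite set of linear hyperplanes in $\mathbb{R}^n$. Chambers are the connected components of $\mathbb{R}^n\setminus\bigcup_{H\in\mathcal{A}}H$; for a chamber $c$, $-c$ is the opposite chamber. For chambers $c,c'$, $S(c,c')$ is the set of hyperplanes of $\mathcal{A}$ separating $c$ from $c'$. A fundamental chamber $c_0$ is fixed, $S(c):=S(c_0,c)$, and the chamber poset $\mathcal{P}(\mathcal{A},c_0)$ orders chambers by $c\le c'$ iff $S(c)\subseteq S(c')$. For an intersection subspace $X$ (an intersection of hyperplanes of $\mathcal{A}$), $\mathcal{A}_X=\{H\in\mathcal{A}: H\supseteq X\}$; for a chamber $c$ of $\mathcal{A}$, $c_X$ denotes the chamber of $\mathcal{A}_X$ containing $c$. A subset $I\subseteq\mathcal{A}$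 is convex (with respect to $c_0$) if for each $H\in\mathcal{A}\setminus I$ there is a chamber $c$ with $H\in S(c)$ and $S(c)\subseteq\mathcal{A}\setminus I$. $I$ is 2-closed if for every codimension 2 intersection subspace $X$, $I\cap\mathcal{A}_X$ is convex in the arrangement $\mathcal{A}_X$ with fundamental chamber $(c_0)_X$; $I$ is biclosed if both $I$ and $\mathcal{A}\setminus I$ are 2-closed. A reduced gallery from $c_0$ to $-c_0$ is a saturated (maximal) chain $c_0=d_0<d_1<\cdots<d_N=-c_0$ of $\mathcal{P}(\mathcal{A},c_0)$; it induces the total order $H_1,\dots,H_N$ of $\mathcal{A}$ where $S(d_{i-1},d_i)=\{H_i\}$. A total order (permutation) of $\mathcal{A}$ is admissible if for every codimension 2 intersection subspace $X$, its restriction to $\mathcal{A}_X$ is the order induced by some reduced gallery of $\mathcal{A}_X$ from $(c_0)_X$ to $-(c_0)_X$. *)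

theory Defs
  imports "HOL-Analysis.Analysis"
begin

definition linear_hyperplane :: "(real^'n) set \<Rightarrow> bool" where
  "linear_hyperplane H \<longleftrightarrow> subspace H \<and> dim H + 1 = CARD('n)"

definition central_arrangement :: "(real^'n) set set \<Rightarrow> bool" where
  "central_arrangement A \<longleftrightarrow> finite A \<and> (\<forall>H\<in>A. linear_hyperplane H)"

definition chambers :: "(real^'n) set set \<Rightarrow> (real^'n) set set" where
  "chambers A = components (UNIV - \<Union>A)"

definition opposite :: "(real^'n) set \<Rightarrow> (real^'n) set" where
  "opposite c = uminus ` c"

definition separates :: "(real^'n) set \<Rightarrow> (real^'n) set \<Rightarrow> (real^'n) set \<Rightarrow> bool" where
  "separates H c c' \<longleftrightarrow>
    (\<exists>a. H = {x. a \<bullet> x = 0} \<and> (\<forall>x\<in>c. a \<bullet> x < 0) \<and> (\<forall>x\<in>c'. a \<bullet> x > 0))"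

definition sep_set ::
  "(real^'n) set set \<Rightarrow> (real^'n) set \<Rightarrow> (real^'n) set \<Rightarrow> (real^'n) set set" where
  "sep_set A c c' = {H \<in> A. separates H c c'}"

definition chamber_le ::
  "(real^'n) set set \<Rightarrow> (real^'n) set \<Rightarrow> (real^'n) set \<Rightarrow> (real^'n) set \<Rightarrow> bool" where
  "chamber_le A c0 c c' \<longleftrightarrow> sep_set A c0 c \<subseteq> sep_set A c0 c'"

definition chamber_less ::
  "(real^'n) set set \<Rightarrow> (real^'n) set \<Rightarrow> (real^'n) set \<Rightarrow> (real^'n) set \<Rightarrow> bool" where
  "chamber_less A c0 c c' \<longleftrightarrow> chamber_le A c0 c c' \<and> c \<noteq> c'"

definition chamber_covers ::
  "(real^'n) set set \<Rightarrow> (real^'n) set \<Rightarrow> (real^'n) set \<Rightarrow> (real^'n) set \<Rightarrow> bool" where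
  "chamber_covers A c0 c c' \<longleftrightarrow> chamber_less A c0 c c' \<and>
    \<not> (\<exists>d\<in>chambers A. chamber_less A c0 c d \<and> chamber_less A c0 d c')"

definition intersection_subspaces :: "(real^'n) set set \<Rightarrow> (real^'n) set set" where
  "intersection_subspaces A = {\<Inter>B | B. B \<subseteq> A}"

definition codim2_subspaces :: "(real^'n) set set \<Rightarrow> (real^'n) set set" where
  "codim2_subspaces A = {X \<in> intersection_subspaces A. dim X + 2 = CARD('n)}"

definition localization :: "(real^'n) set set \<Rightarrow> (real^'n) set \<Rightarrow> (real^'n) set set" where
  "localization A X = {H \<in> A. X \<subseteq> H}"

definition local_chamber ::
  "(real^'n) set set \<Rightarrow> (real^'n) set \<Rightarrow> (real^'n) set \<Rightarrow> (real^'n) set" where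
  "local_chamber A X c = (THE d. d \<in> chambers (localization A X) \<and> c \<subseteq> d)"

definition arr_convex ::
  "(real^'n) set set \<Rightarrow> (real^'n) set \<Rightarrow> (real^'n) set set \<Rightarrow> bool" where
  "arr_convex A c0 I \<longleftrightarrow> I \<subseteq> A \<and>
    (\<forall>H\<in>A - I. \<exists>c\<in>chambers A. H \<in> sep_set A c0 c \<and> sep_set A c0 c \<subseteq> A - I)"

definition two_closed ::
  "(real^'n) set set \<Rightarrow> (real^'n) set \<Rightarrow> (real^'n) set set \<Rightarrow> bool" where
  "two_closed A c0 I \<longleftrightarrow> I \<subseteq> A \<and>
    (\<forall>X\<in>codim2_subspaces A.
      arr_convex (localization A X) (local_chamber A X c0) (I \<inter> localization A X))"

definition biclosed ::
  "(real^'n) set set \<Rightarrow> (real^'n) set \<Rightarrow> (real^'n) set set \<Rightarrow> bool" where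
  "biclosed A c0 I \<longleftrightarrow> I \<subseteq> A \<and> two_closed A c0 I \<and> two_closed A c0 (A - I)"

text \<open>A gallery is given by the list of its chambers \<open>d\<^sub>0, \<dots>, d\<^sub>N\<close>.\<close>

definition reduced_gallery ::
  "(real^'n) set set \<Rightarrow> (real^'n) set \<Rightarrow> (real^'n) set list \<Rightarrow> bool" where
  "reduced_gallery A c0 ds \<longleftrightarrow>
    ds \<noteq> [] \<and> set ds \<subseteq> chambers A \<and> hd ds = c0 \<and> last ds = opposite c0 \<and>
    (\<forall>i. Suc i < length ds \<longrightarrow> chamber_covers A c0 (ds ! i) (ds ! Suc i))"

text \<open>A total order on the finite set \<open>A\<close> is given by the list of the elements of \<open>A\<close> in
  increasing order; its restriction to a subset is the corresponding filtered list.\<close>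

definition total_order_list :: "'a set \<Rightarrow> 'a list \<Rightarrow> bool" where
  "total_order_list A Hs \<longleftrightarrow> distinct Hs \<and> set Hs = A"

definition induces ::
  "(real^'n) set set \<Rightarrow> (real^'n) set list \<Rightarrow> (real^'n) set list \<Rightarrow> bool" where
  "induces A ds Hs \<longleftrightarrow> length ds = Suc (length Hs) \<and>
    (\<forall>i<length Hs. sep_set A (ds ! i) (ds ! Suc i) = {Hs ! i})"

definition admissible ::
  "(real^'n) set set \<Rightarrow> (real^'n) set \<Rightarrow> (real^'n) set list \<Rightarrow> bool" where
  "admissible A c0 Hs \<longleftrightarrow> total_order_list A Hs \<and>
    (\<forall>X\<in>codim2_subspaces A. \<exists>ds.
      reduced_gallery (localization A X) (local_chamber A X c0) ds \<and>
      induces (localization A X) ds (filter (\<lambda>H. H \<in> localization A X) Hs))"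

end

theory Submission
  imports Defs
begin

text \<open>The inversion set \<open>S(c)\<close> of a chamber is convex, witnessed by \<open>-c\<close>, and so is its complement,
  witnessed by \<open>c\<close> itself; hence an order all of whose restrictions to rank two localizations come
  from galleries has biclosed initial segments. By hypothesis these are inversion sets, and the
  chambers they belong to form the required gallery. Reversing a block \<open>A\<^sub>X\<close> preserves
  admissibility: at \<open>X\<close> one takes the opposite local gallery, and any other \<open>A\<^sub>Y\<close> shares at most one
  hyperplane with \<open>A\<^sub>X\<close>.\<close>

section \<open>Chambers as cells of constant sign\<close>

lemma linear_hyperplane_normal:
  assumes "linear_hyperplane (H :: (real^'n) set)"
  shows "\<exists>a. a \<noteq> 0 \<and> H = {x. a \<bullet> x = 0}"
proof -
  have sub: "subspace H" and d: "dim H + 1 = CARD('n)"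
    using assms by (auto simp: linear_hyperplane_def)
  have "dim H < DIM(real^'n)" using d by simp
  then obtain a where a: "a \<noteq> 0" "span H \<subseteq> {x. a \<bullet> x = 0}"
    using lowdim_subset_hyperplane[of H] by blast
  have "dim {x. a \<bullet> x = 0} = dim H"
    using dim_hyperplane[OF a(1)] d by simp
  then have "H = {x. a \<bullet> x = 0}"
    using subspace_dim_equal[OF sub subspace_hyperplane[of a]] a(2) span_superset[of H] by auto
  then show ?thesis using a(1) by blast
qed

text \<open>An arbitrary orientation of each hyperplane. Only comparisons of the sides of two points
  are used later, and these do not depend on the orientation chosen.\<close>

definition normal :: "(real^'n) set \<Rightarrow> real^'n" where
  "normal H = (SOME a. a \<noteq> 0 \<and> H = {x. a \<bullet> x = 0})"

definition pos_side :: "(real^'n) set \<Rightarrow> real^'n \<Rightarrow> bool" where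
  "pos_side H x \<longleftrightarrow> normal H \<bullet> x > 0"

text \<open>\<open>pos_side\<close> is false both on \<open>H\<close> and on its negative side, so
  points of the hyperplanes have to be excluded separately.\<close>

definition cell :: "(real^'n) set set \<Rightarrow> real^'n \<Rightarrow> (real^'n) set" where
  "cell A x = {y. y \<notin> \<Union>A \<and> (\<forall>H\<in>A. pos_side H y \<longleftrightarrow> pos_side H x)}"

lemma mem_hyperplane_iff:
  assumes "central_arrangement A" "H \<in> A"
  shows "x \<in> H \<longleftrightarrow> normal H \<bullet> x = 0"
proof -
  have "linear_hyperplane H" using assms by (simp add: central_arrangement_def)
  then have "normal H \<noteq> 0 \<and> H = {x. normal H \<bullet> x = 0}"
    unfolding normal_def by (rule someI_ex[OF linear_hyperplane_normal])
  then show ?thesis by blast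
qed

lemma pos_side_minus:
  assumes "central_arrangement A" "H \<in> A" "x \<notin> H"
  shows "pos_side H (- x) \<longleftrightarrow> \<not> pos_side H x"
  using assms(3) mem_hyperplane_iff[OF assms(1,2), of x] by (auto simp: pos_side_def)

text \<open>An intersection of open half-spaces is convex, which is how cells are seen to be
  connected.\<close>

lemma cell_eq_halfspaces:
  assumes "central_arrangement A" "x \<notin> \<Union>A"
  shows "cell A x = (\<Inter>H\<in>A. if pos_side H x then {y. normal H \<bullet> y > 0} else {y. normal H \<bullet> y < 0})"
    (is "_ = ?R")
proof -
  have "y \<in> cell A x \<longleftrightarrow> (\<forall>H\<in>A. normal H \<bullet> y \<noteq> 0 \<and> (pos_side H y \<longleftrightarrow> pos_side H x))" for y
    using mem_hyperplane_iff[OF assms(1)] unfolding cell_def by blast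
  moreover have "y \<in> (if pos_side H x then {y. normal H \<bullet> y > 0} else {y. normal H \<bullet> y < 0}) \<longleftrightarrow>
      normal H \<bullet> y \<noteq> 0 \<and> (pos_side H y \<longleftrightarrow> pos_side H x)" for y H
    by (cases "normal H \<bullet> y" "0 :: real" rule: linorder_cases) (simp_all add: pos_side_def)
  ultimately show ?thesis by (intro set_eqI) (simp only: INT_iff)
qed

text \<open>The cell is connected and avoids the hyperplanes, so it lies in the component.
  Conversely, a connected set with points on both sides of \<open>H\<close> meets \<open>H\<close>
  by the intermediate value theorem.\<close>

lemma connected_component_eq_cell:
  assumes "central_arrangement A" "x \<notin> \<Union>A"
  shows "connected_component_set (UNIV - \<Union>A) x = cell A x"
proof
  show "cell A x \<subseteq> connected_component_set (UNIV - \<Union>A) x"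
  proof (rule connected_component_maximal)
    show "x \<in> cell A x" using assms(2) by (auto simp: cell_def)
    show "connected (cell A x)"
      unfolding cell_eq_halfspaces[OF assms]
      by (rule convex_connected, rule convex_INT)
        (simp add: convex_halfspace_lt convex_halfspace_gt)
    show "cell A x \<subseteq> UNIV - \<Union>A" by (auto simp: cell_def)
  qed
next
  let ?C = "connected_component_set (UNIV - \<Union>A) x"
  have C: "connected ?C" "?C \<subseteq> UNIV - \<Union>A" "x \<in> ?C"
    using assms(2) connected_component_subset[of "UNIV - \<Union>A" x]
    by (auto simp: connected_component_refl)
  have "pos_side H y \<longleftrightarrow> pos_side H x" if y: "y \<in> ?C" and H: "H \<in> A" for y H
  proof (rule ccontr)
    assume "\<not> ?thesis"
    then consider "normal H \<bullet> y \<le> 0" "0 \<le> normal H \<bullet> x" | "normal H \<bullet> x \<le> 0" "0 \<le> normal H \<bullet> y"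
      by (fastforce simp: pos_side_def)
    then obtain z where "z \<in> ?C" "normal H \<bullet> z = 0"
      by cases (use connected_ivt_hyperplane[OF C(1)] y C(3) in blast)+
    then show False using C(2) H mem_hyperplane_iff[OF assms(1) H] by blast
  qed
  then show "?C \<subseteq> cell A x" using C(2) by (auto simp: cell_def)
qed

lemma chambers_eq_cells:
  assumes "central_arrangement A"
  shows "chambers A = cell A ` (UNIV - \<Union>A)"
  unfolding chambers_def components_def
  using connected_component_eq_cell[OF assms] by (auto simp: image_iff)

lemma chamber_eq_cell:
  assumes "central_arrangement A" "c \<in> chambers A" "x \<in> c"
  shows "c = cell A x" "x \<notin> \<Union>A"
proof -
  obtain z where "c = cell A z" using assms chambers_eq_cells by blast
  then show "c = cell A x" "x \<notin> \<Union>A" using assms(3) by (auto simp: cell_def)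
qed

section \<open>Separating sets computed from signs at points\<close>

lemma chamber_nonempty:
  assumes "c \<in> chambers A"
  obtains x where "x \<in> c"
  using assms in_components_nonempty unfolding chambers_def by blast

text \<open>The form in \<open>separates\<close> is existentially quantified and must have a sign on
  whole chambers. Since signs are constant on chambers, one sample point of each suffices, with the
  fixed form \<open>normal H\<close>.\<close>

lemma separates_iff:
  assumes A: "central_arrangement A" and c: "c \<in> chambers A" "c' \<in> chambers A"
    and xy: "x \<in> c" "y \<in> c'" and H: "H \<in> A"
  shows "separates H c c' \<longleftrightarrow> pos_side H x \<noteq> pos_side H y"
proof
  have nH: "normal H \<bullet> z \<noteq> 0" if "z \<in> c \<or> z \<in> c'" for z
    using chamber_eq_cell(2)[OF A c(1)] chamber_eq_cell(2)[OF A c(2)] that H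
      mem_hyperplane_iff[OF A H] by blast
  {
    assume "separates H c c'"
    then obtain b where b: "H = {x. b \<bullet> x = 0}" "b \<bullet> x < 0" "b \<bullet> y > 0"
      using xy by (auto simp: separates_def)
    \<comment> \<open>This combination of \<open>x\<close> and \<open>y\<close>, with positive
      coefficients, is a zero of \<open>b\<close>, hence of \<open>normal H\<close>. So
      \<open>normal H\<close> has opposite signs at the two points as well.\<close>
    have "(b \<bullet> y) *\<^sub>R x - (b \<bullet> x) *\<^sub>R y \<in> H"
      by (simp add: b(1) inner_diff_right)
    then have e: "(b \<bullet> y) * (normal H \<bullet> x) = (b \<bullet> x) * (normal H \<bullet> y)"
      using mem_hyperplane_iff[OF A H] by (simp add: inner_diff_right)
    show "pos_side H x \<noteq> pos_side H y"
    proof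
      assume "pos_side H x = pos_side H y"
      then consider "normal H \<bullet> x > 0" "normal H \<bullet> y > 0" | "normal H \<bullet> x < 0" "normal H \<bullet> y < 0"
        using nH[of x] nH[of y] xy by (fastforce simp: pos_side_def)
      then show False
        using e b(2,3) by cases (smt (verit) mult_pos_pos mult_neg_pos mult_pos_neg mult_neg_neg)+
    qed
  next
    assume ne: "pos_side H x \<noteq> pos_side H y"
    have side: "pos_side H z = pos_side H x" if "z \<in> c" for z
      using chamber_eq_cell(1)[OF A c(1) xy(1)] that H by (auto simp: cell_def)
    have side': "pos_side H z = pos_side H y" if "z \<in> c'" for z
      using chamber_eq_cell(1)[OF A c(2) xy(2)] that H by (auto simp: cell_def)
    \<comment> \<open>Oriented so that the second chamber is on the positive side, as
      \<open>separates\<close> demands.\<close>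
    define a where "a = (if pos_side H y then normal H else - normal H)"
    have "H = {x. a \<bullet> x = 0}"
      using mem_hyperplane_iff[OF A H] by (auto simp: a_def)
    moreover have "a \<bullet> z < 0" if "z \<in> c" for z
      using side[OF that] ne nH[of z] that by (auto simp: a_def pos_side_def)
    moreover have "a \<bullet> z > 0" if "z \<in> c'" for z
      using side'[OF that] ne nH[of z] that by (auto simp: a_def pos_side_def)
    ultimately show "separates H c c'" unfolding separates_def by blast
  }
qed

lemma sep_set_eq:
  assumes "central_arrangement A" "c \<in> chambers A" "c' \<in> chambers A" "x \<in> c" "y \<in> c'"
  shows "sep_set A c c' = {H \<in> A. pos_side H x \<noteq> pos_side H y}"
  using separates_iff[OF assms] by (auto simp: sep_set_def)

lemma sep_set_self:
  assumes "central_arrangement A" "c \<in> chambers A"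
  shows "sep_set A c c = {}"
  using chamber_nonempty[OF assms(2)] sep_set_eq[OF assms assms(2)] by blast

text \<open>Two signs differ iff exactly one of them differs from a third. This turns the wall
  crossed by a gallery step into a difference of inversion sets.\<close>

lemma sep_set_sym_diff:
  assumes "central_arrangement A" "c \<in> chambers A" "c' \<in> chambers A" "c'' \<in> chambers A"
  shows "sep_set A c' c'' = sym_diff (sep_set A c c') (sep_set A c c'')"
proof -
  obtain x y z where "x \<in> c" "y \<in> c'" "z \<in> c''" using assms chamber_nonempty by metis
  then show ?thesis using assms by (auto simp: sep_set_eq)
qed

text \<open>The signs on \<open>c0\<close> together with the inversion set determine all signs on a
  chamber, hence its cell.\<close>

lemma sep_set_inj:
  assumes "central_arrangement A" "c0 \<in> chambers A" "c \<in> chambers A" "c' \<in> chambers A"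
    and "sep_set A c0 c = sep_set A c0 c'"
  shows "c = c'"
proof -
  obtain x y z where xyz: "x \<in> c0" "y \<in> c" "z \<in> c'" using assms chamber_nonempty by metis
  have "\<forall>H\<in>A. pos_side H y = pos_side H z"
    using assms(5) unfolding sep_set_eq[OF assms(1-3) xyz(1,2)] sep_set_eq[OF assms(1,2,4) xyz(1,3)]
    by blast
  then have "cell A y = cell A z" by (auto simp: cell_def)
  then show ?thesis using chamber_eq_cell(1) assms xyz by metis
qed

text \<open>Negation preserves every hyperplane and flips every sign off it, so it carries the cell
  of \<open>x\<close> onto the cell of \<open>- x\<close>.\<close>

lemma opposite_chamber:
  assumes A: "central_arrangement A" and c: "c \<in> chambers A"
  shows "opposite c \<in> chambers A"
proof -
  obtain x where x: "x \<in> c" using chamber_nonempty[OF c] .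
  note cx = chamber_eq_cell[OF A c x]
  have un: "- z \<in> \<Union>A \<longleftrightarrow> z \<in> \<Union>A" for z
    using mem_hyperplane_iff[OF A] by auto
  have "z \<in> cell A (- x) \<longleftrightarrow> - z \<in> cell A x" for z
  proof (cases "z \<in> \<Union>A")
    case False
    then have "\<forall>H\<in>A. pos_side H (- z) = (\<not> pos_side H z) \<and> pos_side H (- x) = (\<not> pos_side H x)"
      using pos_side_minus[OF A] cx(2) by blast
    then show ?thesis by (auto simp: cell_def un simp del: Union_iff)
  qed (simp add: cell_def un del: Union_iff)
  then have "opposite c = cell A (- x)"
    unfolding opposite_def cx(1) by (force simp: image_iff)
  then show ?thesis using chambers_eq_cells[OF A] un[of x] cx(2) by blast
qed

lemma sep_set_opposite:
  assumes A: "central_arrangement A" and c: "c0 \<in> chambers A" "c \<in> chambers A"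
  shows "sep_set A c0 (opposite c) = A - sep_set A c0 c"
proof -
  obtain x y where xy: "x \<in> c0" "y \<in> c" using c chamber_nonempty by metis
  have "- y \<in> opposite c" using xy by (simp add: opposite_def)
  moreover have "\<forall>H\<in>A. pos_side H (- y) \<longleftrightarrow> \<not> pos_side H y"
    using pos_side_minus[OF A] chamber_eq_cell(2)[OF A c(2) xy(2)] by blast
  ultimately show ?thesis
    using sep_set_eq[OF A c xy] sep_set_eq[OF A c(1) opposite_chamber[OF A c(2)] xy(1)] by auto
qed

lemma sep_set_convex:
  assumes "central_arrangement A" "c0 \<in> chambers A" "c \<in> chambers A"
  shows "arr_convex A c0 (sep_set A c0 c)" "arr_convex A c0 (A - sep_set A c0 c)"
proof -
  have sub: "sep_set A c0 c \<subseteq> A" by (auto simp: sep_set_def)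
  show "arr_convex A c0 (sep_set A c0 c)"
    unfolding arr_convex_def
    using sub opposite_chamber[OF assms(1,3)] sep_set_opposite[OF assms] by blast
  show "arr_convex A c0 (A - sep_set A c0 c)"
    unfolding arr_convex_def using sub assms(3) by blast
qed

section \<open>Localization of chambers\<close>

lemma central_localization:
  "central_arrangement A \<Longrightarrow> central_arrangement (localization A X)"
  by (auto simp: central_arrangement_def localization_def)

text \<open>Justifies the definite description: the local cell of a point of \<open>c\<close>
  imposes fewer sign conditions and so contains \<open>c\<close>, and any local chamber containing
  that point is this cell.\<close>

lemma local_chamber:
  assumes A: "central_arrangement A" and c: "c \<in> chambers A"
  shows "local_chamber A X c \<in> chambers (localization A X)" "c \<subseteq> local_chamber A X c"
proof -
  let ?L = "localization A X"
  have L: "central_arrangement ?L" using central_localization[OF A] .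
  have sub: "?L \<subseteq> A" by (auto simp: localization_def)
  obtain x where x: "x \<in> c" using chamber_nonempty[OF c] .
  note cx = chamber_eq_cell[OF A c x]
  have "\<exists>!d. d \<in> chambers ?L \<and> c \<subseteq> d"
  proof
    have "c \<subseteq> cell ?L x" unfolding cx(1) using sub by (auto simp: cell_def)
    moreover have "cell ?L x \<in> chambers ?L"
      using cx(2) sub by (auto simp: chambers_eq_cells[OF L])
    ultimately show "cell ?L x \<in> chambers ?L \<and> c \<subseteq> cell ?L x" by blast
    show "d = cell ?L x" if "d \<in> chambers ?L \<and> c \<subseteq> d" for d
      using chamber_eq_cell(1)[OF L] that x by blast
  qed
  from theI'[OF this]
  show "local_chamber A X c \<in> chambers ?L" "c \<subseteq> local_chamber A X c"
    unfolding local_chamber_def by auto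
qed

text \<open>The same sample points serve in the local chambers, so the same signs are compared over
  fewer hyperplanes.\<close>

lemma sep_set_local_chamber:
  assumes A: "central_arrangement A" and c: "c0 \<in> chambers A" "c \<in> chambers A"
  shows "sep_set (localization A X) (local_chamber A X c0) (local_chamber A X c) =
    sep_set A c0 c \<inter> localization A X"
proof -
  obtain x y where xy: "x \<in> c0" "y \<in> c" using c chamber_nonempty by metis
  then have "x \<in> local_chamber A X c0" "y \<in> local_chamber A X c"
    using local_chamber(2)[OF A] c by blast+
  then show ?thesis
    using sep_set_eq[OF A c xy] sep_set_eq[OF central_localization[OF A]]
      local_chamber(1)[OF A] c by (auto simp: localization_def)
qed

section \<open>Galleries as chains of inversion sets\<close>

lemma induces_gallery_prefix:
  assumes A: "central_arrangement A" and c0: "c0 \<in> chambers A"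
    and r: "reduced_gallery A c0 r" "induces A r Hs"
  shows "k \<le> length Hs \<Longrightarrow>
    r ! k \<in> chambers A \<and> sep_set A c0 (r ! k) = set (take k Hs) \<and> distinct (take k Hs)"
proof (induction k)
  case 0
  have "r ! 0 = c0" using r(1) by (auto simp: reduced_gallery_def hd_conv_nth)
  then show ?case using c0 sep_set_self[OF A c0] by simp
next
  case (Suc k)
  have len: "length r = Suc (length Hs)" using r(2) by (simp add: induces_def)
  have IH: "r ! k \<in> chambers A" "sep_set A c0 (r ! k) = set (take k Hs)" "distinct (take k Hs)"
    using Suc by auto
  have ch: "r ! Suc k \<in> chambers A"
    using r(1) len Suc.prems by (auto simp: reduced_gallery_def)
  have "sep_set A (r ! k) (r ! Suc k) = {Hs ! k}"
    using r(2) Suc.prems by (simp add: induces_def)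
  then have sd: "sym_diff (sep_set A c0 (r ! k)) (sep_set A c0 (r ! Suc k)) = {Hs ! k}"
    using sep_set_sym_diff[OF A c0 IH(1) ch] by simp
  \<comment> \<open>The symmetric difference shows only that \<open>Hs ! k\<close> is gained or
    lost. The order relation rules out a loss, which also yields distinctness.\<close>
  have "chamber_covers A c0 (r ! k) (r ! Suc k)"
    using r(1) len Suc.prems by (simp add: reduced_gallery_def)
  then have "sep_set A c0 (r ! k) \<subseteq> sep_set A c0 (r ! Suc k)"
    by (simp add: chamber_covers_def chamber_less_def chamber_le_def)
  with sd have "Hs ! k \<notin> sep_set A c0 (r ! k)"
    "sep_set A c0 (r ! Suc k) = insert (Hs ! k) (sep_set A c0 (r ! k))" by blast+
  then show ?case using IH ch Suc.prems by (simp add: take_Suc_conv_app_nth)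
qed

lemma induces_total_order:
  assumes A: "central_arrangement A" and c0: "c0 \<in> chambers A"
    and r: "reduced_gallery A c0 r" "induces A r Hs"
  shows "total_order_list A Hs"
proof -
  have "r ! length Hs = opposite c0"
    using r by (auto simp: reduced_gallery_def induces_def last_conv_nth)
  then show ?thesis
    using induces_gallery_prefix[OF assms order_refl] sep_set_opposite[OF A c0 c0]
      sep_set_self[OF A c0] by (simp add: total_order_list_def)
qed

text \<open>Reduces the existence of a gallery to the realizability of each initial segment as an
  inversion set. All later galleries are obtained through this criterion.\<close>

lemma gallery_iff_prefixes:
  assumes A: "central_arrangement A" and c0: "c0 \<in> chambers A" and Hs: "total_order_list A Hs"
  shows "(\<exists>r. reduced_gallery A c0 r \<and> induces A r Hs) \<longleftrightarrow>
    (\<forall>k\<le>length Hs. \<exists>c\<in>chambers A. sep_set A c0 c = set (take k Hs))"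
proof
  assume "\<exists>r. reduced_gallery A c0 r \<and> induces A r Hs"
  then show "\<forall>k\<le>length Hs. \<exists>c\<in>chambers A. sep_set A c0 c = set (take k Hs)"
    using induces_gallery_prefix[OF A c0] by blast
next
  assume "\<forall>k\<le>length Hs. \<exists>c\<in>chambers A. sep_set A c0 c = set (take k Hs)"
  then obtain f where f: "\<And>k. k \<le> length Hs \<Longrightarrow> f k \<in> chambers A"
    "\<And>k. k \<le> length Hs \<Longrightarrow> sep_set A c0 (f k) = set (take k Hs)" by metis
  have dist: "distinct Hs" and setHs: "set Hs = A" using Hs by (auto simp: total_order_list_def)
  define r where "r = map f [0..<Suc (length Hs)]"
  have len: "length r = Suc (length Hs)" by (simp add: r_def)
  have nth: "r ! k = f k" if "k \<le> length Hs" for k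
    using that unfolding r_def by (simp del: upt_Suc)
  have step: "Hs ! k \<notin> sep_set A c0 (f k)"
    "sep_set A c0 (f (Suc k)) = insert (Hs ! k) (sep_set A c0 (f k))" if "k < length Hs" for k
    using that f(2)[of k] f(2)[of "Suc k"] dist
    by (auto simp: take_Suc_conv_app_nth in_set_conv_nth nth_eq_iff_index_eq)
  have ind: "induces A r Hs"
    unfolding induces_def
  proof (intro conjI allI impI len)
    fix k assume k: "k < length Hs"
    then show "sep_set A (r ! k) (r ! Suc k) = {Hs ! k}"
      using sep_set_sym_diff[OF A c0 f(1)[of k] f(1)[of "Suc k"]] step[OF k]
      by (auto simp: nth)
  qed
  have "chamber_covers A c0 (r ! k) (r ! Suc k)" if k: "k < length Hs" for k
  proof -
    have "sep_set A c0 (f k) \<noteq> sep_set A c0 (f (Suc k))" using step[OF k] by blast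
    then have "f k \<noteq> f (Suc k)" by metis
    then have "chamber_less A c0 (f k) (f (Suc k))"
      unfolding chamber_less_def chamber_le_def step(2)[OF k] by blast
    moreover have False
      if d: "d \<in> chambers A" "chamber_less A c0 (f k) d" "chamber_less A c0 d (f (Suc k))" for d
    proof -
      \<comment> \<open>An inversion set squeezed between two sets that differ by one element equals
        one of them, and inversion sets determine chambers.\<close>
      have "sep_set A c0 (f k) \<subseteq> sep_set A c0 d"
        "sep_set A c0 d \<subseteq> insert (Hs ! k) (sep_set A c0 (f k))"
        using d(2,3) unfolding chamber_less_def chamber_le_def step(2)[OF k] by simp_all
      then have "sep_set A c0 d = sep_set A c0 (f k) \<or> sep_set A c0 d = sep_set A c0 (f (Suc k))"
        unfolding step(2)[OF k] by blast
      then have "d = f k \<or> d = f (Suc k)"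
        using sep_set_inj[OF A c0 d(1)] f(1) k by (metis Suc_leI less_imp_le_nat)
      then show False using d by (auto simp: chamber_less_def)
    qed
    ultimately show ?thesis using k by (auto simp: chamber_covers_def nth)
  qed
  \<comment> \<open>The end points are forced by injectivity: the empty prefix belongs to
    \<open>c0\<close>, the full one to \<open>opposite c0\<close>.\<close>
  moreover have "f 0 = c0"
    using sep_set_inj[OF A c0 f(1)[of 0] c0] f(2)[of 0] sep_set_self[OF A c0] by simp
  moreover have "f (length Hs) = opposite c0"
    using sep_set_inj[OF A c0 f(1)[OF order_refl] opposite_chamber[OF A c0]] f(2)[OF order_refl]
      sep_set_opposite[OF A c0 c0] sep_set_self[OF A c0] setHs by simp
  moreover have "r \<noteq> []" "set r \<subseteq> chambers A" using f(1) by (auto simp: r_def)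
  ultimately have "reduced_gallery A c0 r"
    using len nth by (simp add: reduced_gallery_def hd_conv_nth last_conv_nth)
  then show "\<exists>r. reduced_gallery A c0 r \<and> induces A r Hs" using ind by blast
qed

text \<open>Lifts an initial segment of a restricted order to one of the full order, where a chamber
  is already known.\<close>

lemma take_filter_prefix:
  assumes "k \<le> length (filter P xs)"
  obtains j where "j \<le> length xs" "take k (filter P xs) = filter P (take j xs)"
proof -
  have "\<exists>j\<le>length xs. take k (filter P xs) = filter P (take j xs)"
    using assms
  proof (induction xs arbitrary: k)
    case (Cons x xs)
    show ?case
    \<comment> \<open>Split off because the witness \<open>Suc j\<close> below always takes in the
      head, which may satisfy \<open>P\<close>.\<close>
    proof (cases "k = 0")
      case True
      then show ?thesis by (intro exI[of _ 0]) simp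
    next
      case False
      let ?k = "if P x then k - 1 else k"
      have "?k \<le> length (filter P xs)" using Cons.prems by (auto split: if_splits)
      then obtain j where "j \<le> length xs" "take ?k (filter P xs) = filter P (take j xs)"
        using Cons.IH by blast
      then show ?thesis using False
        by (intro exI[of _ "Suc j"]) (auto simp: take_Cons' split: if_splits)
    qed
  qed simp
  then show thesis using that by blast
qed

section \<open>Admissible orders and biclosed initial segments\<close>

lemma total_order_list_localization:
  "total_order_list A Hs \<Longrightarrow>
    total_order_list (localization A X) (filter (\<lambda>H. H \<in> localization A X) Hs)"
  by (auto simp: total_order_list_def localization_def)

text \<open>An initial segment of the restricted order is the trace of an initial segment of
  \<open>Hs\<close>. The chamber realizing the latter localizes to one realizing the former.\<close>

lemma gallery_imp_admissible:
  assumes A: "central_arrangement A" and c0: "c0 \<in> chambers A"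
    and r: "reduced_gallery A c0 r" "induces A r Hs"
  shows "admissible A c0 Hs"
  unfolding admissible_def
proof (intro conjI ballI)
  show tot: "total_order_list A Hs" using induces_total_order[OF assms] .
  fix X
  let ?L = "localization A X"
  let ?F = "filter (\<lambda>H. H \<in> ?L) Hs"
  have "\<exists>d\<in>chambers ?L. sep_set ?L (local_chamber A X c0) d = set (take k ?F)"
    if k: "k \<le> length ?F" for k
  proof -
    obtain j where j: "j \<le> length Hs" "take k ?F = filter (\<lambda>H. H \<in> ?L) (take j Hs)"
      using take_filter_prefix[OF k] .
    obtain c where "c \<in> chambers A" "sep_set A c0 c = set (take j Hs)"
      using gallery_iff_prefixes[OF A c0 tot] r j(1) by blast
    then show ?thesis
      using sep_set_local_chamber[OF A c0] local_chamber(1)[OF A] j(2)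
      by (intro bexI[of _ "local_chamber A X c"]) auto
  qed
  then show "\<exists>ds. reduced_gallery ?L (local_chamber A X c0) ds \<and> induces ?L ds ?F"
    using gallery_iff_prefixes[OF central_localization[OF A] local_chamber(1)[OF A c0]
        total_order_list_localization[OF tot]] by blast
qed

lemma admissible_prefix_biclosed:
  assumes A: "central_arrangement A" and c0: "c0 \<in> chambers A" and adm: "admissible A c0 Hs"
  shows "biclosed A c0 (set (take k Hs))"
proof -
  let ?I = "set (take k Hs)"
  have tot: "total_order_list A Hs" using adm by (simp add: admissible_def)
  have sub: "?I \<subseteq> A" using tot set_take_subset[of k Hs] by (auto simp: total_order_list_def)
  have "arr_convex (localization A X) (local_chamber A X c0) (?I \<inter> localization A X) \<and>
      arr_convex (localization A X) (local_chamber A X c0) ((A - ?I) \<inter> localization A X)"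
    if X: "X \<in> codim2_subspaces A" for X
  proof -
    let ?L = "localization A X"
    let ?F = "\<lambda>xs. filter (\<lambda>H. H \<in> ?L) xs"
    note L = central_localization[OF A, of X] local_chamber(1)[OF A c0, of X]
    \<comment> \<open>The number of hyperplanes of \<open>?L\<close> among the first
      \<open>k\<close>: the trace of this segment is the initial segment of length \<open>?j\<close>
      of the restricted order.\<close>
    let ?j = "length (?F (take k Hs))"
    have F: "?F Hs = ?F (take k Hs) @ ?F (drop k Hs)"
      by (metis append_take_drop_id filter_append)
    then have "take ?j (?F Hs) = ?F (take k Hs)" "?j \<le> length (?F Hs)" by simp_all
    moreover have "\<exists>ds. reduced_gallery ?L (local_chamber A X c0) ds \<and> induces ?L ds (?F Hs)"
      using adm X by (simp add: admissible_def)
    ultimately obtain d where d: "d \<in> chambers ?L"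
      "sep_set ?L (local_chamber A X c0) d = set (?F (take k Hs))"
      using gallery_iff_prefixes[OF L total_order_list_localization[OF tot]] by metis
    have "?I \<inter> ?L = sep_set ?L (local_chamber A X c0) d" using d(2) by auto
    moreover have "(A - ?I) \<inter> ?L = ?L - sep_set ?L (local_chamber A X c0) d"
      using d(2) by (auto simp: localization_def)
    ultimately show ?thesis using sep_set_convex[OF L d(1)] by simp
  qed
  then show ?thesis using sub by (auto simp: biclosed_def two_closed_def)
qed

text \<open>Here the hypothesis on biclosed sets enters: it realizes every initial segment of an
  admissible order by a chamber.\<close>

lemma admissible_imp_gallery:
  assumes A: "central_arrangement A" and c0: "c0 \<in> chambers A"
    and bi: "\<And>I. I \<subseteq> A \<Longrightarrow> biclosed A c0 I \<Longrightarrow> \<exists>c\<in>chambers A. I = sep_set A c0 c"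
    and adm: "admissible A c0 Hs"
  shows "\<exists>r. reduced_gallery A c0 r \<and> induces A r Hs"
proof -
  have tot: "total_order_list A Hs" using adm by (simp add: admissible_def)
  have "\<exists>c\<in>chambers A. sep_set A c0 c = set (take k Hs)" for k
    using bi[OF _ admissible_prefix_biclosed[OF A c0 adm, of k]]
      admissible_prefix_biclosed[OF A c0 adm, of k] by (auto simp: biclosed_def)
  then show ?thesis using gallery_iff_prefixes[OF A c0 tot] by blast
qed

section \<open>Reversing galleries and blocks\<close>

lemma gallery_rev:
  assumes A: "central_arrangement A" and c0: "c0 \<in> chambers A"
    and r: "reduced_gallery A c0 r" "induces A r Hs"
  shows "\<exists>r'. reduced_gallery A c0 r' \<and> induces A r' (rev Hs)"
proof -
  have tot: "total_order_list A Hs" using induces_total_order[OF assms] .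
  then have tot': "total_order_list A (rev Hs)" by (simp add: total_order_list_def)
  have "\<exists>c\<in>chambers A. sep_set A c0 c = set (take k (rev Hs))" for k
  proof -
    \<comment> \<open>The first \<open>k\<close> entries of the reversed list are the complement of
      the first \<open>?m\<close> entries of \<open>Hs\<close>, so the opposite of the old chamber
      realizes them. For \<open>k\<close> beyond the length, \<open>?m\<close> is 0 and the
      complement is all of \<open>A\<close>.\<close>
    let ?m = "length Hs - k"
    obtain c where c: "c \<in> chambers A" "sep_set A c0 c = set (take ?m Hs)"
      using gallery_iff_prefixes[OF A c0 tot] r by (meson diff_le_self)
    have "set (take ?m Hs) \<inter> set (drop ?m Hs) = {}" "set (take ?m Hs) \<union> set (drop ?m Hs) = A"
      using tot set_append[of "take ?m Hs" "drop ?m Hs"]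
      by (simp_all add: total_order_list_def set_take_disj_set_drop_if_distinct)
    then have "A - set (take ?m Hs) = set (take k (rev Hs))" by (auto simp: take_rev)
    then show ?thesis
      using c sep_set_opposite[OF A c0 c(1)] opposite_chamber[OF A c(1)] by metis
  qed
  then show ?thesis using gallery_iff_prefixes[OF A c0 tot'] by blast
qed

text \<open>Two distinct hyperplanes meet in codimension 2, so \<open>X\<close>, contained in their
  intersection, fills it for reasons of dimension.\<close>

lemma codim2_subspace_eq_Int:
  fixes A :: "(real^'n) set set"
  assumes A: "central_arrangement A" and X: "X \<in> codim2_subspaces A"
    and H: "H \<in> localization A X" "K \<in> localization A X" "H \<noteq> K"
  shows "X = H \<inter> K"
proof -
  have lin: "linear_hyperplane L" if "L \<in> A" for L
    using A that by (simp add: central_arrangement_def)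
  have HK: "subspace H" "subspace K" "dim H + 1 = CARD('n)" "dim K + 1 = CARD('n)" "X \<subseteq> H \<inter> K"
    using lin H by (auto simp: localization_def linear_hyperplane_def)
  have subX: "subspace X"
    using X lin by (auto simp: codim2_subspaces_def intersection_subspaces_def linear_hyperplane_def
        intro!: subspace_Inter)
  have subI: "subspace (H \<inter> K)" using HK by (simp add: subspace_inter)
  \<comment> \<open>Without a drop in dimension \<open>H\<close> would lie in \<open>K\<close>, and
    equal dimensions would force \<open>H = K\<close>.\<close>
  have "\<not> dim H \<le> dim (H \<inter> K)"
  proof
    assume "dim H \<le> dim (H \<inter> K)"
    then have "H \<inter> K = H" using subspace_dim_equal[OF subI HK(1)] by blast
    then have "H = K" using subspace_dim_equal[OF HK(1,2)] HK(3,4) by auto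
    then show False using H(3) by simp
  qed
  then have "dim (H \<inter> K) \<le> dim X" using HK(3) X by (simp add: codim2_subspaces_def)
  then show ?thesis using subspace_dim_equal[OF subX subI HK(5)] by blast
qed

text \<open>Two distinct hyperplanes through both \<open>X\<close> and \<open>Y\<close> would have
  each of these as their intersection. So the filtered block has at most one entry and reversal does
  not change it.\<close>

lemma rev_filter_block:
  fixes A :: "(real^'n) set set"
  assumes A: "central_arrangement A" and X: "X \<in> codim2_subspaces A" "Y \<in> codim2_subspaces A"
    and ne: "X \<noteq> Y" and bs: "distinct bs" "set bs = localization A X"
  shows "rev (filter (\<lambda>H. H \<in> localization A Y) bs) = filter (\<lambda>H. H \<in> localization A Y) bs"
proof -
  let ?F = "filter (\<lambda>H. H \<in> localization A Y) bs"
  have "H = K" if "H \<in> set ?F" "K \<in> set ?F" for H K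
  proof (rule ccontr)
    assume "H \<noteq> K"
    then have "X = H \<inter> K" "Y = H \<inter> K"
      using codim2_subspace_eq_Int[OF A X(1), of H K] codim2_subspace_eq_Int[OF A X(2), of H K]
        that bs(2) by auto
    then show False using ne by simp
  qed
  then have "card (set ?F) \<le> Suc 0" by (simp only: card_le_Suc0_iff_eq[OF finite_set]) blast
  moreover have "distinct ?F" using bs(1) by simp
  ultimately have "length ?F \<le> Suc 0" using distinct_card by metis
  then show ?thesis by (cases ?F) auto
qed

lemma admissible_rev_block:
  assumes A: "central_arrangement A" and c0: "c0 \<in> chambers A"
    and adm: "admissible A c0 (us @ bs @ vs)" and X: "X \<in> codim2_subspaces A"
    and bs: "set bs = localization A X"
  shows "admissible A c0 (us @ rev bs @ vs)"
  unfolding admissible_def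
proof (intro conjI ballI)
  have tot: "total_order_list A (us @ bs @ vs)" using adm by (simp add: admissible_def)
  then show "total_order_list A (us @ rev bs @ vs)" by (simp add: total_order_list_def)
  fix Y assume Y: "Y \<in> codim2_subspaces A"
  let ?L = "localization A Y"
  let ?F = "\<lambda>xs. filter (\<lambda>H. H \<in> ?L) xs"
  obtain ds where ds: "reduced_gallery ?L (local_chamber A Y c0) ds"
    "induces ?L ds (?F (us @ bs @ vs))"
    using adm Y unfolding admissible_def by blast
  show "\<exists>ds. reduced_gallery ?L (local_chamber A Y c0) ds \<and> induces ?L ds (?F (us @ rev bs @ vs))"
  proof (cases "X = Y")
    case True
    \<comment> \<open>The block already contains every hyperplane of \<open>?L\<close>, and no entry
      repeats, so the restriction to \<open>?L\<close> is the block itself.\<close>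
    have "set us \<inter> ?L = {}" "set vs \<inter> ?L = {}"
      using tot bs True by (auto simp: total_order_list_def)
    then have "?F us = []" "?F vs = []" "?F bs = bs"
      using bs True by (auto simp: filter_empty_conv filter_id_conv)
    then have "?F (us @ bs @ vs) = bs" "?F (us @ rev bs @ vs) = rev bs"
      by (simp_all flip: rev_filter)
    then show ?thesis
      using gallery_rev[OF central_localization[OF A] local_chamber(1)[OF A c0] ds] by simp
  next
    case False
    have "distinct bs" using tot by (simp add: total_order_list_def)
    then have "?F (us @ rev bs @ vs) = ?F (us @ bs @ vs)"
      using rev_filter_block[OF A X Y False _ bs] by (simp flip: rev_filter)
    then show ?thesis using ds by metis
  qed
qed

theorem theorem1p3:
  fixes A :: "(real^'n) set set" and c0 :: "(real^'n) set"
  assumes "central_arrangement A"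
    and "c0 \<in> chambers A"
    and "\<And>I. I \<subseteq> A \<Longrightarrow> biclosed A c0 I \<Longrightarrow> \<exists>c\<in>chambers A. I = sep_set A c0 c"
  shows "(\<forall>Hs. total_order_list A Hs \<longrightarrow>
            (admissible A c0 Hs \<longleftrightarrow> (\<exists>r. reduced_gallery A c0 r \<and> induces A r Hs))) \<and>
         (\<forall>r Hs X us bs vs.
            reduced_gallery A c0 r \<longrightarrow> induces A r Hs \<longrightarrow> X \<in> codim2_subspaces A \<longrightarrow>
            Hs = us @ bs @ vs \<longrightarrow> set bs = localization A X \<longrightarrow>
            (\<exists>r'. reduced_gallery A c0 r' \<and> induces A r' (us @ rev bs @ vs)))"
proof (intro conjI allI impI iffI)
  fix Hs assume "admissible A c0 Hs"
  then show "\<exists>r. reduced_gallery A c0 r \<and> induces A r Hs"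
    using admissible_imp_gallery[OF assms] by blast
next
  fix Hs assume "\<exists>r. reduced_gallery A c0 r \<and> induces A r Hs"
  then show "admissible A c0 Hs" using gallery_imp_admissible[OF assms(1,2)] by blast
next
  fix r Hs X us bs vs
  assume r: "reduced_gallery A c0 r" "induces A r Hs" and X: "X \<in> codim2_subspaces A"
    and Hs: "Hs = us @ bs @ vs" and bs: "set bs = localization A X"
  \<comment> \<open>The new gallery is not built by hand: the block is reversed at the level of
    admissible orders, and the first part of the theorem then supplies the chambers.\<close>
  have "admissible A c0 (us @ rev bs @ vs)"
    using admissible_rev_block[OF assms(1,2) _ X bs]
      gallery_imp_admissible[OF assms(1,2) r] Hs by blast
  then show "\<exists>r'. reduced_gallery A c0 r' \<and> induces A r' (us @ rev bs @ vs)"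
    using admissible_imp_gallery[OF assms] by blast
qed

end
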